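(* For every positive integer $f$ and for all $n$ and sizes of $S,T$, there exist an undirected unweighted $n$-node graph $G=(V,E)$ and subsets $S,T\subseteq V$ such that every $(2f)$-FT $1$-additive $S\times T$ spanner (hence every $(2f)$-FT $S\times T$ preserver) of $G$ has $\Omega\left(|S|^{1/(f+1)}\cdot|T|^{1/(f+1)}\cdot (n/f)^{2-2/(f+1)}\right)$ edges.
   Context: For a graph $G=(V,E)$ and $P\subseteq V\times V$, a subgraph $H\subseteq G$ is an $f'$-FT $\beta$-additive $P$-pairwise spanner if $\mathrm{dist}_{H\setminus F}(s,t)\leq \mathrm{dist}_{G\setminus F}(s,t)+\beta$ for all $(s,t)\in P$ and all $F\subseteq E$ with $|F|\leq f'$; a preserver is the case $\beta=0$. An $S\times T$ spanner is the case $P=S\times T$. *)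

theory Defs
  imports Complex_Main "HOL-Library.Extended_Nat"
begin

datatype 'a ugraph = UGraph (verts: "'a set") (edges: "'a set set")

definition simple_graph :: "'a ugraph \<Rightarrow> bool" where
  "simple_graph G \<longleftrightarrow>
     finite (verts G) \<and> (\<forall>e\<in>edges G. e \<subseteq> verts G \<and> card e = 2)"

definition subgraph :: "'a ugraph \<Rightarrow> 'a ugraph \<Rightarrow> bool" where
  "subgraph H G \<longleftrightarrow>
     simple_graph H \<and> verts H \<subseteq> verts G \<and> edges H \<subseteq> edges G"

definition delete_edges :: "'a ugraph \<Rightarrow> 'a set set \<Rightarrow> 'a ugraph" where
  "delete_edges G F = UGraph (verts G) (edges G - F)"

definition walk :: "'a ugraph \<Rightarrow> 'a \<Rightarrow> 'a list \<Rightarrow> 'a \<Rightarrow> bool" where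
  "walk G s p t \<longleftrightarrow>
     p \<noteq> [] \<and> hd p = s \<and> last p = t \<and> set p \<subseteq> verts G \<and>
     successively (\<lambda>u v. {u, v} \<in> edges G) p"

text \<open>A walk is the list of its vertices, so its length is one less than that of the list.
  The infimum of the empty set is infinity, which covers disconnected pairs and vertices
  outside the graph.\<close>

definition graph_dist :: "'a ugraph \<Rightarrow> 'a \<Rightarrow> 'a \<Rightarrow> enat" where
  "graph_dist G s t = (INF p\<in>{p. walk G s p t}. enat (length p - 1))"

definition ft_additive_spanner ::
    "nat \<Rightarrow> nat \<Rightarrow> ('a \<times> 'a) set \<Rightarrow> 'a ugraph \<Rightarrow> 'a ugraph \<Rightarrow> bool" where
  "ft_additive_spanner k \<beta> P G H \<longleftrightarrow>
     subgraph H G \<and>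
     (\<forall>(s, t)\<in>P. \<forall>F. F \<subseteq> edges G \<and> card F \<le> k \<longrightarrow>
        graph_dist (delete_edges H F) s t \<le> graph_dist (delete_edges G F) s t + enat \<beta>)"

definition ft_preserver ::
    "nat \<Rightarrow> ('a \<times> 'a) set \<Rightarrow> 'a ugraph \<Rightarrow> 'a ugraph \<Rightarrow> bool" where
  "ft_preserver k P G H \<longleftrightarrow> ft_additive_spanner k 0 P G H"

end

theory Submission
  imports Defs "HOL-Library.Sublist" "HOL-Library.Countable"
begin

text \<open>
  A source is the root of a tree whose leaves have the property that every leaf can be isolated by
  at most \<open>f\<close> edge faults: every other leaf becomes unreachable from the root or is at least two
  steps deeper. Give every source and every sink such a tree and join all source leaves to all sink
  leaves. For source leaf \<open>x\<close> and sink leaf \<open>y\<close>, fail the \<open>f + f\<close> edges that isolate them: then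
  every route avoiding the edge \<open>x y\<close> is at least two steps longer than the one through it, so
  a spanner of additive stretch 1 must contain all edges between the leaves.

  The trees are built by joining: the root of a tree \<open>B\<close> hangs from the new root by one edge, the root
  of a tree \<open>A\<close> by a path longer than the depth of \<open>B\<close>. Isolating a leaf of \<open>A\<close> costs one
  additional fault, which cuts off \<open>B\<close>; isolating a leaf of \<open>B\<close> costs nothing more. A leaf is hence
  described by a word of at most \<open>f\<close> choices of \<open>A\<close> and \<open>b\<close> choices of \<open>B\<close>, so up to
  \<open>(f + b) choose b\<close> leaves are possible, at an amortised price of at most \<open>1 + 3 b\<close> vertices per leaf.
  With \<open>q\<close> vertices available per tree, \<open>b\<close> is about \<open>f (q / f) powr (1 / (f + 1))\<close>.
\<close>

section \<open>Tries whose leaves can be isolated by few faults\<close>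

text \<open>Trees are tries: vertices are words, the root is the empty word, and the edge from \<open>p\<close> to its
  parent \<open>butlast p\<close> is represented by \<open>p\<close>. In \<open>isolates F X x\<close> the set \<open>F\<close> consists of the failed
  edges and \<open>X\<close> of the leaves.\<close>

definition isolates :: "'a list set \<Rightarrow> 'a list set \<Rightarrow> 'a list \<Rightarrow> bool" where
  "isolates F X x \<longleftrightarrow> (\<forall>q\<in>F. \<not> prefix q x) \<and>
     (\<forall>y\<in>X. y \<noteq> x \<longrightarrow> (\<exists>q\<in>F. prefix q y) \<or> length x + 2 \<le> length y)"

definition isolable :: "nat \<Rightarrow> 'a list set \<Rightarrow> bool" where
  "isolable f X \<longleftrightarrow> (\<forall>x\<in>X. \<exists>F. finite F \<and> card F \<le> f \<and> isolates F X x)"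

text \<open>The vertex set of the trie generated by \<open>X\<close>; its nonempty members also name
  the edges.\<close>

definition prefix_closure :: "'a list set \<Rightarrow> 'a list set" where
  "prefix_closure X = {p. \<exists>x\<in>X. prefix p x}"

lemma finite_prefix_closure: "finite X \<Longrightarrow> finite (prefix_closure X)"
proof -
  assume "finite X"
  moreover have "prefix_closure X = (\<Union>x\<in>X. set (prefixes x))"
    by (auto simp: prefix_closure_def)
  ultimately show ?thesis by simp
qed

text \<open>A leaf \<open>x\<close> of \<open>B\<close> lands at depth \<open>length x + 1\<close>,
  every leaf of \<open>A\<close> at depth at least \<open>l\<close>; the margin 3 in
  \<open>len\<close> thus leaves the required gap of 2 without a further fault. For a leaf of
  \<open>A\<close>, the extra fault \<open>[False]\<close> detaches the whole copy of
  \<open>B\<close>.\<close>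

lemma isolable_join:
  fixes A B :: "bool list set"
  assumes A: "isolable f A" and B: "isolable (Suc f) B"
    and len: "\<And>x. x \<in> B \<Longrightarrow> length x + 3 \<le> l" and "l > 0"
  shows "isolable (Suc f) ((@) (replicate l True) ` A \<union> (#) False ` B)" (is "isolable _ ?X")
  unfolding isolable_def
proof
  fix w assume w: "w \<in> ?X"
  show "\<exists>F. finite F \<and> card F \<le> Suc f \<and> isolates F ?X w"
  proof (cases "w \<in> (#) False ` B")
    case True
    then obtain x where x: "x \<in> B" "w = False # x" by blast
    from B x(1) obtain F where F: "finite F" "card F \<le> Suc f" "isolates F B x"
      unfolding isolable_def by blast
    have "isolates ((#) False ` F) ?X w"
      using F(3) x len[OF x(1)] unfolding isolates_def by auto
    moreover have "card ((#) False ` F) \<le> Suc f"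
      using card_image_le[OF F(1)] F(2) le_trans by blast
    ultimately show ?thesis using F(1) by blast
  next
    case False
    then obtain x where x: "x \<in> A" "w = replicate l True @ x" using w by blast
    from A x(1) obtain F where F: "finite F" "card F \<le> f" "isolates F A x"
      unfolding isolable_def by blast
    let ?F = "insert [False] ((@) (replicate l True) ` F)"
    have nw: "\<not> prefix [False] w"
      using x \<open>l > 0\<close> by (cases l) auto
    have "isolates ?F ?X w"
      using F(3) x nw unfolding isolates_def by auto
    moreover have "card ?F \<le> Suc f"
      using card_insert_le_m1 card_image_le[OF F(1), of "(@) (replicate l True)"] F(1,2)
      by (simp add: card_insert_if)
    ultimately show ?thesis using F(1) by (intro exI[of _ ?F]) simp
  qed
qed

text \<open>The \<open>l\<close> additional vertices are the new root and the interior of the long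
  path, whose far end is the root of \<open>A\<close>.\<close>

lemma card_prefix_closure_join:
  fixes A B :: "bool list set"
  assumes "finite A" "finite B" "l > 0"
  shows "card (prefix_closure ((@) (replicate l True) ` A \<union> (#) False ` B))
           \<le> l + card (prefix_closure A) + card (prefix_closure B)"
proof -
  let ?R = "(\<lambda>i. replicate i True) ` {..<l}"
  let ?A = "(@) (replicate l True) ` prefix_closure A"
  let ?B = "(#) False ` prefix_closure B"
  have "prefix_closure ((@) (replicate l True) ` A \<union> (#) False ` B) \<subseteq> ?R \<union> ?A \<union> ?B"
  proof
    fix p assume "p \<in> prefix_closure ((@) (replicate l True) ` A \<union> (#) False ` B)"
    then consider x where "x \<in> A" "prefix p (replicate l True @ x)"
      | x where "x \<in> B" "prefix p (False # x)"
      unfolding prefix_closure_def by auto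
    then show "p \<in> ?R \<union> ?A \<union> ?B"
    proof cases
      case 1
      show ?thesis
      proof (cases "length p < l")
        case True
        then have "p = take (length p) (replicate l True)"
          using 1(2) by (auto simp: prefix_def append_eq_append_conv_if)
        then have "p = replicate (length p) True" using True by (simp add: min_def)
        then show ?thesis using True by blast
      next
        case False
        then obtain q where "p = replicate l True @ q"
          using 1(2) prefix_length_prefix[of "replicate l True" "replicate l True @ x" p]
          by (auto simp: prefix_def)
        then show ?thesis using 1 by (auto simp: prefix_closure_def)
      qed
    next
      case 2
      then show ?thesis using assms(3)
        by (cases p) (auto simp: prefix_closure_def intro: image_eqI[where x = 0])
    qed
  qed
  moreover have "finite (?R \<union> ?A \<union> ?B)"
    using assms finite_prefix_closure by blast
  ultimately have "card (prefix_closure ((@) (replicate l True) ` A \<union> (#) False ` B))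
      \<le> card (?R \<union> ?A \<union> ?B)" by (rule card_mono[rotated])
  also have "\<dots> \<le> card ?R + card ?A + card ?B"
    using card_Un_le[of "?R \<union> ?A" ?B] card_Un_le[of ?R ?A] by linarith
  also have "\<dots> \<le> l + card (prefix_closure A) + card (prefix_closure B)"
    using card_image_le[of "{..<l}" "\<lambda>i. replicate i True"]
      card_image_le[OF finite_prefix_closure[OF assms(1)], of "(@) (replicate l True)"]
      card_image_le[OF finite_prefix_closure[OF assms(2)], of "(#) False"] by simp
  finally show ?thesis .
qed

text \<open>Induction along Pascal's rule. The path of length \<open>3 * LB\<close> is charged to
  the \<open>LB\<close> leaves of \<open>B\<close> at 3 each, and a leaf pays only where it goes to
  \<open>B\<close>, at most \<open>b\<close> times; the summand 1 pays for the single vertex at the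
  bottom of the recursion.\<close>

lemma isolable_words_exist:
  assumes "1 \<le> L" "L \<le> (f + b) choose b"
  shows "\<exists>X :: bool list set. finite X \<and> card X = L \<and> isolable f X \<and>
     (\<forall>x\<in>X. length x + 3 \<le> 3 * L) \<and> card (prefix_closure X) \<le> L * (1 + 3 * b)"
  using assms
proof (induction "f + b" arbitrary: f b L rule: less_induct)
  case less
  show ?case
  proof (cases "L = 1")
    case True
    have "prefix_closure {[]} = {[] :: bool list}" by (auto simp: prefix_closure_def)
    then show ?thesis
      by (intro exI[of _ "{[]}"]) (auto simp: True isolable_def isolates_def intro: exI[of _ "{}"])
  next
    case False
    with less.prems obtain f' b' where fb: "f = Suc f'" "b = Suc b'"
      by (cases f; cases b) auto
    \<comment> \<open>\<open>A\<close> receives as many leaves as Pascal's rule allows, but one is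
      always left for \<open>B\<close>, so both parts are nonempty.\<close>
    define LA where "LA = min (L - 1) ((f' + b) choose b)"
    define LB where "LB = L - LA"
    have "(f + b) choose b = ((f + b') choose b') + ((f' + b) choose b)"
      by (simp add: fb)
    moreover have pos: "(f' + b) choose b > 0" by simp
    ultimately have LA: "1 \<le> LA" "LA \<le> (f' + b) choose b"
      and LB: "1 \<le> LB" "LB \<le> (f + b') choose b'" and L: "L = LA + LB"
      using less.prems False zero_less_binomial[of b' "f + b'"] unfolding LA_def LB_def by linarith+
    obtain A :: "bool list set" where A: "finite A" "card A = LA" "isolable f' A"
      "\<forall>x\<in>A. length x + 3 \<le> 3 * LA" "card (prefix_closure A) \<le> LA * (1 + 3 * b)"
      using less.hyps[of f' b LA] LA fb by auto
    obtain B :: "bool list set" where B: "finite B" "card B = LB" "isolable f B"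
      "\<forall>x\<in>B. length x + 3 \<le> 3 * LB" "card (prefix_closure B) \<le> LB * (1 + 3 * b')"
      using less.hyps[of f b' LB] LB fb by auto
    let ?l = "3 * LB"
    let ?X = "(@) (replicate ?l True) ` A \<union> (#) False ` B"
    have "card ?X = LA + LB"
    proof -
      have "(@) (replicate ?l True) ` A \<inter> (#) False ` B = {}"
        using LB by (cases ?l) auto
      then show ?thesis
        using A B by (simp add: card_Un_disjoint card_image inj_on_def)
    qed
    moreover have "isolable f ?X"
      unfolding fb(1) using A(3) B(3,4) fb(1) LB by (intro isolable_join) auto
    moreover have "\<forall>x\<in>?X. length x + 3 \<le> 3 * L"
      using A(4) B(4) LA LB L by fastforce
    moreover have "card (prefix_closure ?X) \<le> L * (1 + 3 * b)"
      using card_prefix_closure_join[OF A(1) B(1), of ?l] A(5) B(5) LB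
      by (simp add: L fb algebra_simps)
    ultimately show ?thesis using A(1) B(1) L by (intro exI[of _ ?X]) auto
  qed
qed

section \<open>Potentials as lower bounds for distances\<close>

lemma lipschitz_walk:
  fixes \<phi> :: "'a \<Rightarrow> int"
  assumes "walk G s p t" and "\<And>u v. {u, v} \<in> edges G \<Longrightarrow> \<phi> v - \<phi> u \<le> 1"
  shows "\<phi> t - \<phi> s \<le> int (length p - 1)"
proof -
  have "successively (\<lambda>u v. {u, v} \<in> edges G) p \<Longrightarrow> p \<noteq> [] \<Longrightarrow>
      \<phi> (last p) - \<phi> (hd p) \<le> int (length p - 1)"
  proof (induction p rule: induct_list012)
    case (3 x y zs)
    then have "\<phi> (last (y # zs)) - \<phi> y \<le> int (length zs)" "\<phi> y - \<phi> x \<le> 1"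
      using assms(2) by auto
    then show ?case by auto
  qed auto
  then show ?thesis using assms(1) by (auto simp: walk_def)
qed

text \<open>Without \<open>e\<close>, each surviving edge of \<open>H\<close> raises
  \<open>\<phi>\<close> by at most 1, so walks in \<open>H\<close> from \<open>s\<close> to
  \<open>t\<close> have length at least \<open>length p + 1\<close>. As \<open>p\<close> lists
  vertices, its length as a walk is \<open>length p - 1\<close>, and stretch 1 permits only
  \<open>length p\<close>.\<close>

lemma spanner_edge_forced:
  fixes \<phi> :: "'a \<Rightarrow> int"
  assumes sp: "ft_additive_spanner k 1 P G H" and P: "(s, t) \<in> P"
    and F: "F \<subseteq> edges G" "card F \<le> k"
    and w: "walk (delete_edges G F) s p t"
    and lip: "\<And>u v. {u, v} \<in> edges G \<Longrightarrow> {u, v} \<notin> F \<Longrightarrow> {u, v} \<noteq> e \<Longrightarrow> \<phi> v - \<phi> u \<le> 1"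
    and gap: "\<phi> t - \<phi> s \<ge> int (length p) + 1"
  shows "e \<in> edges H"
proof (rule ccontr)
  assume e: "e \<notin> edges H"
  have sub: "edges H \<subseteq> edges G" using sp by (auto simp: ft_additive_spanner_def subgraph_def)
  have pne: "p \<noteq> []" using w by (simp add: walk_def)
  have "graph_dist (delete_edges H F) s t \<le> graph_dist (delete_edges G F) s t + enat 1"
    using sp P F unfolding ft_additive_spanner_def by blast
  also have "graph_dist (delete_edges G F) s t \<le> enat (length p - 1)"
    unfolding graph_dist_def using w by (auto intro: INF_lower2)
  finally have "graph_dist (delete_edges H F) s t \<le> enat (length p)"
    using pne by (cases p) (auto simp: one_enat_def)
  moreover have "enat (length p + 1) \<le> graph_dist (delete_edges H F) s t"
    unfolding graph_dist_def
  proof (rule INF_greatest)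
    fix q assume "q \<in> {q. walk (delete_edges H F) s q t}"
    then have "\<phi> t - \<phi> s \<le> int (length q - 1)"
      using lip sub e by (intro lipschitz_walk[of "delete_edges H F"]) (auto simp: delete_edges_def)
    then show "enat (length p + 1) \<le> enat (length q - 1)" using gap by auto
  qed
  ultimately have "enat (length p + 1) \<le> enat (length p)" by (rule order_trans[rotated])
  then show False by simp
qed


text \<open>Truncating the depth at \<open>a + 2\<close>, which is also the value on the part cut off by \<open>F\<close>, gives a
  function that is 1-Lipschitz along all surviving edges and so bounds distances from below.\<close>

definition cut_depth :: "'a list set \<Rightarrow> nat \<Rightarrow> 'a list \<Rightarrow> int" where
  "cut_depth F a p =
     (if \<exists>q\<in>F. prefix q p then int a + 2 else min (int (length p)) (int a + 2))"

text \<open>A faulty prefix of \<open>p\<close> other than \<open>p\<close> itself is already a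
  prefix of the parent, so both ends of a surviving edge lie on the same side of the cut.\<close>

lemma cut_depth_lipschitz:
  assumes "p \<noteq> []" "p \<notin> F"
  shows "\<bar>cut_depth F a p - cut_depth F a (butlast p)\<bar> \<le> 1"
proof -
  obtain p' z where "p = p' @ [z]" using assms(1) by (metis append_butlast_last_id)
  then have "(\<exists>q\<in>F. prefix q p) \<longleftrightarrow> (\<exists>q\<in>F. prefix q (butlast p))"
    using assms(2) by auto
  then show ?thesis by (auto simp: cut_depth_def min_def)
qed

text \<open>Truncation puts all other leaves exactly at the cap, whether cut off or merely deep.
  Exact values are wanted because the potential on the sink side uses the negated function.\<close>

lemma cut_depth_isolates:
  assumes "isolates F X x"
  shows "cut_depth F (length x) [] = 0"
    and "cut_depth F (length x) x = int (length x)"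
    and "y \<in> X \<Longrightarrow> y \<noteq> x \<Longrightarrow> cut_depth F (length x) y = int (length x) + 2"
proof -
  show "cut_depth F (length x) [] = 0" "cut_depth F (length x) x = int (length x)"
    using assms by (auto simp: cut_depth_def isolates_def)
  show "cut_depth F (length x) y = int (length x) + 2" if "y \<in> X" "y \<noteq> x"
  proof (cases "\<exists>q\<in>F. prefix q y")
    case False
    then have "length x + 2 \<le> length y" using assms that by (auto simp: isolates_def)
    then show ?thesis by (simp add: cut_depth_def)
  qed (simp add: cut_depth_def)
qed

section \<open>The graph of tries joined by cross edges\<close>

text \<open>The flag is \<open>False\<close> for trees of sources and \<open>True\<close> for trees
  of sinks; \<open>i\<close> numbers the trees of one side.\<close>

definition node :: "bool \<Rightarrow> nat \<Rightarrow> 'a::countable list \<Rightarrow> nat" where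
  "node d i p = to_nat (d, i, p)"

lemma node_eq_iff [simp]: "node d i p = node d' i' p' \<longleftrightarrow> d = d' \<and> i = i' \<and> p = p'"
  by (simp add: node_def)

definition tree_edge :: "bool \<Rightarrow> nat \<Rightarrow> 'a::countable list \<Rightarrow> nat set" where
  "tree_edge d i p = {node d i (butlast p), node d i p}"

definition tree_edges :: "bool \<Rightarrow> nat \<Rightarrow> 'a::countable list set \<Rightarrow> nat set set" where
  "tree_edges d k X = {tree_edge d i p |i p. i < k \<and> p \<in> prefix_closure X \<and> p \<noteq> []}"

definition tree_nodes :: "bool \<Rightarrow> nat \<Rightarrow> 'a::countable list set \<Rightarrow> nat set" where
  "tree_nodes d k X = (\<lambda>(i, p). node d i p) ` ({..<k} \<times> prefix_closure X)"

definition cross_edges :: "nat \<Rightarrow> 'a::countable list set \<Rightarrow> nat \<Rightarrow> 'a list set \<Rightarrow> nat set set" where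
  "cross_edges k X l Y =
     (\<lambda>((i, x), (j, y)). {node False i x, node True j y}) ` (({..<k} \<times> X) \<times> ({..<l} \<times> Y))"

lemma card_cross_edges: "card (cross_edges k X l Y) = (k * card X) * (l * card Y)"
proof -
  have "inj_on (\<lambda>((i, x), (j, y)). {node False i x, node True j y})
          (({..<k} \<times> X) \<times> ({..<l} \<times> Y))"
    by (auto simp: inj_on_def doubleton_eq_iff)
  then show ?thesis
    unfolding cross_edges_def by (simp add: card_image card_cartesian_product)
qed

lemma finite_tree_nodes: "finite X \<Longrightarrow> finite (tree_nodes d k X)"
  by (simp add: tree_nodes_def finite_prefix_closure)

lemma card_tree_nodes_le: "finite X \<Longrightarrow> card (tree_nodes d k X) \<le> k * card (prefix_closure X)"
  using card_image_le[of "{..<k} \<times> prefix_closure X" "\<lambda>(i, p). node d i p"]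
  by (simp add: tree_nodes_def finite_prefix_closure card_cartesian_product)

lemma prefix_closure_prefix: "p \<in> prefix_closure X \<Longrightarrow> prefix q p \<Longrightarrow> q \<in> prefix_closure X"
  unfolding prefix_closure_def using prefix_order.trans by blast

lemma node_in_tree_nodes: "i < k \<Longrightarrow> p \<in> prefix_closure X \<Longrightarrow> node d i p \<in> tree_nodes d k X"
  by (force simp: tree_nodes_def)

lemma subset_prefix_closure: "X \<subseteq> prefix_closure X"
  by (auto simp: prefix_closure_def)

lemma tree_edge_props:
  assumes "e \<in> tree_edges d k X"
  shows "e \<subseteq> tree_nodes d k X" "card e = 2"
proof -
  obtain i p where e: "e = tree_edge d i p" "i < k" "p \<in> prefix_closure X" "p \<noteq> []"
    using assms by (auto simp: tree_edges_def)
  have "butlast p \<in> prefix_closure X"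
    using e(3) prefix_closure_prefix prefixeq_butlast by blast
  then show "e \<subseteq> tree_nodes d k X"
    using e by (auto simp: tree_edge_def intro: node_in_tree_nodes)
  have "butlast p \<noteq> p" using e(4) by (metis append_butlast_last_id append_self_conv not_Cons_self2)
  then show "card e = 2" using e(1) by (simp add: tree_edge_def)
qed

lemma cross_edge_props:
  assumes "e \<in> cross_edges k X l Y"
  shows "e \<subseteq> tree_nodes False k X \<union> tree_nodes True l Y" "card e = 2"
proof -
  obtain i x j y where "i < k" "x \<in> X" "j < l" "y \<in> Y" "e = {node False i x, node True j y}"
    using assms by (auto simp: cross_edges_def)
  then show "e \<subseteq> tree_nodes False k X \<union> tree_nodes True l Y" "card e = 2"
    using subset_prefix_closure[of X] subset_prefix_closure[of Y]
    by (auto intro: node_in_tree_nodes)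
qed

text \<open>The vertex set is a parameter so that isolated vertices can bring the total to exactly
  \<open>n\<close>.\<close>

definition trie_graph ::
    "nat set \<Rightarrow> nat \<Rightarrow> 'a::countable list set \<Rightarrow> nat \<Rightarrow> 'a list set \<Rightarrow> nat ugraph" where
  "trie_graph V k X l Y =
     UGraph V (tree_edges False k X \<union> tree_edges True l Y \<union> cross_edges k X l Y)"

text \<open>Every edge on the branch to \<open>x\<close> is named by a prefix of \<open>x\<close>,
  hence spared by \<open>F\<close>.\<close>

lemma successively_branch:
  assumes "x \<in> X" "i < k" "\<forall>q\<in>F. \<not> prefix q x"
  shows "successively (\<lambda>u v. {u, v} \<in> tree_edges d k X - tree_edge d i ` F)
           (map (\<lambda>m. node d i (take m x)) [0..<Suc (length x)])"
proof -
  have "{node d i (take m x), node d i (take (Suc m) x)} \<in> tree_edges d k X - tree_edge d i ` F"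
    if m: "m < length x" for m
  proof -
    have "{node d i (take m x), node d i (take (Suc m) x)} = tree_edge d i (take (Suc m) x)"
      using m by (simp add: tree_edge_def butlast_take)
    moreover have "take (Suc m) x \<in> prefix_closure X"
      using assms(1) take_is_prefix by (auto simp: prefix_closure_def)
    moreover have "take (Suc m) x \<noteq> []" using m by auto
    moreover have "{node d i (take m x), node d i (take (Suc m) x)} \<noteq> tree_edge d i q"
      if "q \<in> F" for q
      using assms(3) that take_is_prefix by (auto simp: tree_edge_def doubleton_eq_iff)
    ultimately show ?thesis using assms(2) unfolding tree_edges_def by fastforce
  qed
  then show ?thesis
    by (subst successively_conv_nth) (simp del: upt_Suc add: nth_append)
qed

section \<open>Forced cross edges\<close>

lemma trie_graph_edge_forced:
  fixes X Y :: "'a::countable list set"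
  assumes V: "tree_nodes False k X \<union> tree_nodes True l Y \<subseteq> V"
    and X: "isolable f X" "x \<in> X" "i < k" and Y: "isolable f Y" "y \<in> Y" "j < l"
    and P: "(node False i ([] :: 'a list), node True j ([] :: 'a list)) \<in> P"
    and sp: "ft_additive_spanner (2 * f) 1 P (trie_graph V k X l Y) H"
  shows "{node False i x, node True j y} \<in> edges H"
proof -
  let ?G = "trie_graph V k X l Y"
  let ?e = "{node False i x, node True j y}"
  obtain A where A: "finite A" "card A \<le> f" "isolates A X x"
    using X by (auto simp: isolable_def)
  obtain B where B: "finite B" "card B \<le> f" "isolates B Y y"
    using Y by (auto simp: isolable_def)
  \<comment> \<open>Isolating sets may contain words outside the tries, while a fault set must
    consist of edges of the graph.\<close>
  define F where "F = (tree_edge False i ` A \<union> tree_edge True j ` B) \<inter> edges ?G"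
  \<comment> \<open>The potential has to rise by two more than the walk through \<open>?e\<close> is long: it takes the values
     \<open>length x\<close> at \<open>x\<close>, \<open>length x + 3\<close> at \<open>y\<close>, and \<open>length x + 2\<close> and \<open>length x + 1\<close> at the other
     source and sink leaves, so \<open>?e\<close> is the only cross edge along which it changes by more than 1.\<close>
  define \<psi> where "\<psi> = (\<lambda>(d, m, p).
    if d then int (length x) + int (length y) + 3 -
        (if m = j then cut_depth B (length y) p else int (length y) + 2)
    else if m = i then cut_depth A (length x) p else int (length x) + 2)"
  define \<phi> :: "nat \<Rightarrow> int" where "\<phi> v = \<psi> (from_nat v)" for v
  have \<phi>: "\<phi> (node d m p) = \<psi> (d, m, p)" for d m p
    by (simp add: \<phi>_def node_def)
  let ?p1 = "map (\<lambda>m. node False i (take m x)) [0..<Suc (length x)]"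
  let ?p2 = "map (\<lambda>m. node True j (take m y)) [0..<Suc (length y)]"
  \<comment> \<open>Each fault lies inside one tree, so it hits neither \<open>?e\<close> nor a
    branch on the other side.\<close>
  have noncross: "?e \<notin> tree_edge d m ` C" for d m and C :: "'a list set"
    by (auto simp: tree_edge_def doubleton_eq_iff)
  have other: "tree_edge d m p \<noteq> tree_edge (\<not> d) m' q" for d m m' and p q :: "'a list"
    by (auto simp: tree_edge_def doubleton_eq_iff)
  note other = other[of False, simplified] other[of True, simplified]
  have s1: "successively (\<lambda>u v. {u, v} \<in> edges ?G - F) ?p1"
    by (rule successively_mono[OF successively_branch[of x X i k A]])
       (use X A in \<open>auto simp: isolates_def\<close>, auto simp: trie_graph_def F_def tree_edges_def other)
  have "successively (\<lambda>u v. {u, v} \<in> edges ?G - F) ?p2"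
    by (rule successively_mono[OF successively_branch[of y Y j l B]])
       (use Y B in \<open>auto simp: isolates_def\<close>, auto simp: trie_graph_def F_def tree_edges_def other)
  then have s2: "successively (\<lambda>u v. {u, v} \<in> edges ?G - F) (rev ?p2)"
    by (simp add: insert_commute del: upt_Suc)
  have e: "?e \<in> edges ?G - F"
    using X Y noncross by (force simp: trie_graph_def cross_edges_def F_def)
  have walk: "walk (delete_edges ?G F) (node False i ([] :: 'a list)) (?p1 @ rev ?p2)
          (node True j ([] :: 'a list))"
    unfolding walk_def
  proof (intro conjI)
    have "take m x \<in> prefix_closure X" "take m y \<in> prefix_closure Y" for m
      using X(2) Y(2) take_is_prefix unfolding prefix_closure_def by blast+
    then have "set ?p1 \<subseteq> tree_nodes False k X" "set ?p2 \<subseteq> tree_nodes True l Y"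
      using X(3) Y(3) by (auto simp del: upt_Suc intro!: node_in_tree_nodes)
    then show "set (?p1 @ rev ?p2) \<subseteq> verts (delete_edges ?G F)"
      using V by (auto simp: delete_edges_def trie_graph_def simp del: upt_Suc)
    have "last ?p1 = node False i x" "last ?p2 = node True j y" by auto
    then show "successively (\<lambda>u v. {u, v} \<in> edges (delete_edges ?G F)) (?p1 @ rev ?p2)"
      using s1 s2 e
      by (auto simp: successively_append_iff delete_edges_def hd_rev simp del: upt_Suc)
  qed (auto simp: hd_map hd_append last_rev simp del: upt_Suc)
  have lip: "\<phi> v - \<phi> u \<le> 1" if uv: "{u, v} \<in> edges ?G" "{u, v} \<notin> F" "{u, v} \<noteq> ?e" for u v
  proof -
    consider (tree) d m and p :: "'a list" where "{u, v} = tree_edge d m p" "p \<noteq> []"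
      | (cross) i' x' j' y' where "{u, v} = {node False i' x', node True j' y'}" "x' \<in> X" "y' \<in> Y"
      using uv(1) by (auto simp: trie_graph_def tree_edges_def cross_edges_def)
    then show ?thesis
    proof cases
      case tree
      \<comment> \<open>On each tree other than the two chosen ones the potential is constant;
        within those two, a surviving edge is not named by a faulty word.\<close>
      have "\<not> (d = False \<and> m = i \<and> p \<in> A)" "\<not> (d = True \<and> m = j \<and> p \<in> B)"
        using uv(1,2) tree by (auto simp: F_def)
      then have "\<bar>\<psi> (d, m, p) - \<psi> (d, m, butlast p)\<bar> \<le> 1"
        using cut_depth_lipschitz[OF tree(2), of A "length x"]
          cut_depth_lipschitz[OF tree(2), of B "length y"]
        by (auto simp: \<psi>_def)
      then show ?thesis using tree(1) by (auto simp: tree_edge_def doubleton_eq_iff \<phi>)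
    next
      case cross
      have ne: "\<not> (i' = i \<and> x' = x \<and> j' = j \<and> y' = y)" using cross uv(3) by auto
      have "\<psi> (False, i', x') = (if i' = i \<and> x' = x then int (length x) else int (length x) + 2)"
        using cut_depth_isolates[OF A(3)] cross(2) by (auto simp: \<psi>_def)
      moreover have "\<psi> (True, j', y') =
          (if j' = j \<and> y' = y then int (length x) + 3 else int (length x) + 1)"
        using cut_depth_isolates[OF B(3)] cross(3) by (auto simp: \<psi>_def)
      ultimately have "\<bar>\<psi> (False, i', x') - \<psi> (True, j', y')\<bar> \<le> 1"
        using ne by auto
      then show ?thesis using cross(1) by (auto simp: doubleton_eq_iff \<phi>)
    qed
  qed
  \<comment> \<open>Equality holds: the potential rises from 0 to
    \<open>length x + length y + 3\<close>, and the walk has \<open>length x + length y + 2\<close>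
    vertices.\<close>
  have gap: "\<phi> (node True j ([] :: 'a list)) - \<phi> (node False i ([] :: 'a list))
      \<ge> int (length (?p1 @ rev ?p2)) + 1"
    using cut_depth_isolates(1)[OF A(3)] cut_depth_isolates(1)[OF B(3)] by (simp add: \<phi> \<psi>_def)
  have card: "card F \<le> 2 * f"
  proof -
    have "card F \<le> card (tree_edge False i ` A \<union> tree_edge True j ` B)"
      unfolding F_def using A B by (intro card_mono) auto
    also have "\<dots> \<le> card (tree_edge False i ` A) + card (tree_edge True j ` B)"
      by (rule card_Un_le)
    also have "\<dots> \<le> card A + card B"
      using A B by (intro add_mono card_image_le)
    finally show ?thesis using A B by simp
  qed
  have "F \<subseteq> edges ?G" by (simp add: F_def)
  from spanner_edge_forced[OF sp P this card walk lip gap] show ?thesis .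
qed

text \<open>Terminals beyond the roots may be chosen arbitrarily, since additional pairs only impose
  more on \<open>H\<close>.\<close>

lemma trie_graph_exists:
  fixes X Y :: "'a::countable list set"
  assumes X: "finite X" "X \<noteq> {}" "isolable f X" and Y: "finite Y" "Y \<noteq> {}" "isolable f Y"
    and size: "k * card (prefix_closure X) + l * card (prefix_closure Y) \<le> n"
    and k: "k \<le> \<sigma>" "\<sigma> \<le> n" and l: "l \<le> \<tau>" "\<tau> \<le> n"
  shows "\<exists>(G :: nat ugraph) S T.
    simple_graph G \<and> card (verts G) = n \<and>
    S \<subseteq> verts G \<and> card S = \<sigma> \<and> T \<subseteq> verts G \<and> card T = \<tau> \<and>
    (\<forall>H. ft_additive_spanner (2 * f) 1 (S \<times> T) G H \<longrightarrow>
       (k * card X) * (l * card Y) \<le> card (edges H))"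
proof -
  let ?V = "tree_nodes False k X \<union> tree_nodes True l Y"
  have finV: "finite ?V" using X Y by (simp add: finite_tree_nodes)
  have "card ?V \<le> n"
    using card_Un_le[of "tree_nodes False k X" "tree_nodes True l Y"] size
      card_tree_nodes_le[OF X(1), of False k] card_tree_nodes_le[OF Y(1), of True l] by linarith
  moreover have "n \<le> card (?V \<union> {..<n})"
    using card_mono[of "?V \<union> {..<n}" "{..<n}"] finV by simp
  ultimately obtain V where V: "?V \<subseteq> V" "V \<subseteq> ?V \<union> {..<n}" "card V = n"
    using exists_subset_between[of ?V n "?V \<union> {..<n}"] finV by auto
  have fV: "finite V" using V(2) finV finite_subset by blast
  have root: "[] \<in> prefix_closure X" "[] \<in> prefix_closure Y"
    using X(2) Y(2) by (auto simp: prefix_closure_def)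
  let ?S = "(\<lambda>i. node False i ([] :: 'a list)) ` {..<k}"
  let ?T = "(\<lambda>i. node True i ([] :: 'a list)) ` {..<l}"
  have "?S \<subseteq> V" "?T \<subseteq> V"
    using V(1) node_in_tree_nodes[OF _ root(1), of _ k False]
      node_in_tree_nodes[OF _ root(2), of _ l True] by auto
  moreover have "card ?S = k" "card ?T = l" by (simp_all add: card_image inj_on_def)
  ultimately obtain S T where S: "?S \<subseteq> S" "S \<subseteq> V" "card S = \<sigma>"
    and T: "?T \<subseteq> T" "T \<subseteq> V" "card T = \<tau>"
    using exists_subset_between[of ?S \<sigma> V] exists_subset_between[of ?T \<tau> V] k l V(3) fV by metis
  let ?G = "trie_graph V k X l Y"
  have simple: "simple_graph ?G"
    unfolding simple_graph_def
  proof (intro conjI ballI)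
    fix e assume "e \<in> edges ?G"
    then consider "e \<in> tree_edges False k X" | "e \<in> tree_edges True l Y" | "e \<in> cross_edges k X l Y"
      by (auto simp: trie_graph_def)
    then have "e \<subseteq> ?V \<and> card e = 2"
    proof cases
      case 1
      show ?thesis using tree_edge_props[OF 1] by blast
    next
      case 2
      show ?thesis using tree_edge_props[OF 2] by blast
    next
      case 3
      show ?thesis using cross_edge_props[OF 3] by blast
    qed
    then show "e \<subseteq> verts ?G" "card e = 2" using V(1) by (auto simp: trie_graph_def)
  qed (simp add: trie_graph_def fV)
  have "(k * card X) * (l * card Y) \<le> card (edges H)"
    if H: "ft_additive_spanner (2 * f) 1 (S \<times> T) ?G H" for H
  proof -
    have sH: "simple_graph H" using H by (simp add: ft_additive_spanner_def subgraph_def)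
    then have "edges H \<subseteq> Pow (verts H)" "finite (verts H)" by (auto simp: simple_graph_def)
    then have "finite (edges H)" by (meson finite_Pow_iff finite_subset)
    moreover have "{node False i x, node True j y} \<in> edges H"
      if "i < k" "x \<in> X" "j < l" "y \<in> Y" for i x j y
      using trie_graph_edge_forced[OF V(1) X(3) that(2,1) Y(3) that(4,3) _ H] S(1) T(1) that by auto
    then have "cross_edges k X l Y \<subseteq> edges H" by (auto simp: cross_edges_def)
    ultimately show ?thesis using card_mono card_cross_edges by metis
  qed
  then show ?thesis
    using simple V(3) S T by (intro exI[of _ ?G] exI[of _ S] exI[of _ T]) (auto simp: trie_graph_def)
qed


section \<open>Choice of the parameters\<close>

text \<open>With \<open>m / s = f * q\<close> vertices per tree and \<open>z ^ (f + 1) = q\<close>,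
  about \<open>z ^ f\<close> leaves fit: \<open>b\<close> close to \<open>f * z\<close> allows
  \<open>((f + b) / f) ^ f\<close> leaves, at a price of order \<open>f * z\<close> each.\<close>

lemma isolable_words_within_budget:
  fixes f m s :: nat
  assumes "1 \<le> f" "1 \<le> s" "s * f \<le> m"
  shows "\<exists>X :: bool list set. finite X \<and> X \<noteq> {} \<and> isolable f X \<and>
    s * card (prefix_closure X) \<le> m \<and>
    (real m / (real s * real f)) powr (real f / (real f + 1)) / 8 \<le> real (card X)"
proof -
  define q where "q = real m / (real s * real f)"
  define z where "z = q powr (1 / (real f + 1))"
  have "real s * real f \<le> real m" using assms(3) by (metis of_nat_le_iff of_nat_mult)
  then have q: "1 \<le> q" using assms(1,2) by (simp add: q_def divide_simps)
  have z: "1 \<le> z" unfolding z_def using q by (intro ge_one_powr_ge_zero) auto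
  have zf: "z ^ f = q powr (real f / (real f + 1))"
    using q by (simp add: z_def powr_powr flip: powr_realpow)
  have "z ^ Suc f = q powr (1 / (real f + 1) * real (Suc f))"
    using q unfolding z_def by (subst powr_realpow[symmetric]) (auto simp: powr_powr)
  then have zf1: "z ^ Suc f = q" using q by (simp add: field_simps)
  show ?thesis
  proof (cases "z ^ f < 4")
    \<comment> \<open>Here the value of \<open>L\<close> used in the other case would be 0; a single
      vertex suffices because the claimed bound is below 1.\<close>
    case True
    obtain X :: "bool list set" where "finite X" "card X = 1" "isolable f X"
      "card (prefix_closure X) \<le> 1"
      using isolable_words_exist[of 1 f 0] by auto
    moreover have "s \<le> m" using assms by (metis le_trans mult_le_mono2 mult.right_neutral)
    moreover have "s * card (prefix_closure X) \<le> m"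
      using \<open>s \<le> m\<close> \<open>card (prefix_closure X) \<le> 1\<close> by (metis le_trans mult_le_mono2 mult.right_neutral)
    ultimately show ?thesis using True zf q_def by (intro exI[of _ X]) auto
  next
    case False
    define b where "b = nat \<lfloor>real f * z\<rfloor>"
    define L where "L = nat \<lfloor>z ^ f / 4\<rfloor>"
    have fz: "1 \<le> real f * z" using assms(1) z mult_mono[of 1 "real f" 1 z] by simp
    have b: "real b \<le> real f * z" "real f * z < real b + 1"
      unfolding b_def using fz by linarith+
    have "1 \<le> \<lfloor>z ^ f / 4\<rfloor>" using False by (simp add: le_floor_iff)
    \<comment> \<open>Rounding down a number that is at least 1 loses at most a factor 2, which
      turns the 4 into 8.\<close>
    then have L: "real L \<le> z ^ f / 4" "z ^ f / 8 \<le> real L"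
      unfolding L_def by linarith+
    have L1: "1 \<le> L" using L(2) False by linarith
    have "z \<le> (real f + real b) / real f"
      using b(2) assms(1) by (simp add: field_simps)
    then have "z ^ f \<le> (real (f + b) / real f) ^ f"
      using z by (intro power_mono) auto
    also have "\<dots> \<le> real ((f + b) choose f)"
      using binomial_ge_n_over_k_pow_k[of f "f + b"] by simp
    also have "(f + b) choose f = (f + b) choose b"
      using binomial_symmetric[of f "f + b"] by simp
    finally have "real L \<le> real ((f + b) choose b)" using L(1) zero_le_power[of z f] z
      by linarith
    then obtain X :: "bool list set" where X: "finite X" "card X = L" "isolable f X"
      "card (prefix_closure X) \<le> L * (1 + 3 * b)"
      using isolable_words_exist[of L f b] L1 by auto
    \<comment> \<open>As \<open>f * z\<close> is at least 1, the price \<open>1 + 3 * b\<close> is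
      at most \<open>4 * f * z\<close>; the 4 in \<open>L\<close> compensates for this.\<close>
    have "real (L * (1 + 3 * b)) \<le> (z ^ f / 4) * (4 * (real f * z))"
      using L(1) b(1) fz by (simp only: of_nat_mult) (intro mult_mono, auto)
    also have "\<dots> = real f * q" using zf1 by (simp add: mult.commute)
    finally have "real s * real (L * (1 + 3 * b)) \<le> real s * (real f * q)"
      by (intro mult_left_mono) auto
    also have "\<dots> = real m" using assms by (simp add: q_def)
    finally have "s * (L * (1 + 3 * b)) \<le> m" by (metis of_nat_le_iff of_nat_mult)
    then have "s * card (prefix_closure X) \<le> m" using X(4) by (meson le_trans mult_le_mono2)
    then show ?thesis using X L(2) L1 zf q_def by (intro exI[of _ X]) auto
  qed
qed

text \<open>If there is room for \<open>\<sigma>\<close> trees of \<open>f\<close> vertices, the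
  previous bound is multiplied by \<open>\<sigma>\<close>; otherwise about \<open>m / f\<close>
  trees with at least one leaf each suffice, because \<open>?D\<close> is at most
  \<open>2 * n / f\<close>. The 24 is 8 times the factor 3 from
  \<open>n \<le> 3 * m\<close>.\<close>

lemma isolable_words_for_terminals:
  fixes f n \<sigma> :: nat
  assumes "1 \<le> f" "2 \<le> n" "1 \<le> \<sigma>" "\<sigma> \<le> n"
  shows "\<exists>(X :: bool list set) s. finite X \<and> X \<noteq> {} \<and> isolable f X \<and> s \<le> \<sigma> \<and>
    s * card (prefix_closure X) \<le> n div 2 \<and>
    real \<sigma> powr (1 / (real f + 1)) * (real n / real f) powr (real f / (real f + 1)) / 24
      \<le> real (s * card X)"
proof -
  define \<alpha> where "\<alpha> = 1 / (real f + 1)"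
  define m where "m = n div 2"
  have \<alpha>: "0 < \<alpha>" "\<alpha> < 1" "real f / (real f + 1) = 1 - \<alpha>"
    using assms(1) by (auto simp: \<alpha>_def field_simps)
  have m: "n \<le> 3 * m" "1 \<le> m" using assms(2) unfolding m_def by linarith+
  let ?D = "real \<sigma> powr \<alpha> * (real n / real f) powr (1 - \<alpha>)"
  have f: "0 < real f" using assms(1) by simp
  \<comment> \<open>Replacing \<open>\<sigma>\<close> by \<open>n\<close> leaves
    \<open>n / f\<close> times \<open>f powr \<alpha>\<close>, and the latter is at most 2 since
    \<open>f \<le> 2 ^ (f + 1)\<close>.\<close>
  have D: "?D \<le> 2 * (real n / real f)"
  proof -
    have "f \<le> 2 ^ Suc f" using less_exp[of f] unfolding power_Suc by linarith
    then have "real f \<le> 2 ^ Suc f" by (metis of_nat_le_iff of_nat_numeral of_nat_power)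
    then have "real f powr \<alpha> \<le> (2 ^ Suc f) powr \<alpha>" using \<alpha> by (intro powr_mono2) auto
    also have "\<dots> = (2 powr (real f + 1)) powr \<alpha>"
      by (subst powr_realpow[symmetric]) (auto simp: add.commute)
    also have "\<dots> = 2" by (simp add: powr_powr \<alpha>_def)
    finally have f2: "real f powr \<alpha> \<le> 2" .
    have "?D \<le> real n powr \<alpha> * (real n / real f) powr (1 - \<alpha>)"
      using assms \<alpha> by (intro mult_right_mono powr_mono2) auto
    also have "real n powr \<alpha> = (real n / real f) powr \<alpha> * real f powr \<alpha>"
      using f by (simp flip: powr_mult)
    also have "(real n / real f) powr \<alpha> * real f powr \<alpha> * (real n / real f) powr (1 - \<alpha>)
        = real f powr \<alpha> * (real n / real f)"
      using f assms(2) by (simp add: mult.commute mult.left_commute flip: powr_add)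
    also have "\<dots> \<le> 2 * (real n / real f)" using f2 by (intro mult_right_mono) auto
    finally show ?thesis .
  qed
  show ?thesis
  proof (cases "m < f")
    \<comment> \<open>Not even one tree of \<open>f\<close> vertices fits, but then
      \<open>?D\<close> is at most 6 and one leaf is enough.\<close>
    case True
    obtain X :: "bool list set" where X: "finite X" "card X = 1" "isolable f X"
      "card (prefix_closure X) \<le> 1"
      using isolable_words_exist[of 1 f 0] by auto
    have "real n / real f \<le> 3" using True m f by (simp add: field_simps)
    then have "?D / 24 \<le> real (1 * card X)" using D X(2) by simp
    then show ?thesis
      using X m assms(3) \<alpha>(3) by (intro exI[of _ X] exI[of _ 1]) (auto simp: m_def \<alpha>_def)
  next
    case False
    define s where "s = min \<sigma> (m div f)"
    have "1 \<le> m div f" using False assms(1) by (simp add: Suc_leI div_greater_zero_iff)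
    then have s: "1 \<le> s" "s \<le> \<sigma>" "s \<le> m div f" using assms(3) by (auto simp: s_def)
    have "s * f \<le> m" using s(3) by (metis div_times_less_eq_dividend le_trans mult_le_mono1)
    then obtain X :: "bool list set" where X: "finite X" "X \<noteq> {}" "isolable f X"
      "s * card (prefix_closure X) \<le> m"
      "(real m / (real s * real f)) powr (1 - \<alpha>) / 8 \<le> real (card X)"
      using isolable_words_within_budget[OF assms(1) s(1)] \<alpha>(3) by metis
    have nm: "real n / real f / 3 \<le> real m / real f" using m(1) f by (simp add: field_simps)
    have "?D / 24 \<le> real (s * card X)"
    proof (cases "s = \<sigma>")
      case True
      have "(3 :: real) powr (1 - \<alpha>) \<le> 3 powr 1" using \<alpha> by (intro powr_mono) auto
      then have "(real n / real f) powr (1 - \<alpha>) / 3 \<le> (real n / real f) powr (1 - \<alpha>) / 3 powr (1 - \<alpha>)"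
        by (intro divide_left_mono) auto
      also have "\<dots> = (real n / real f / 3) powr (1 - \<alpha>)"
        by (rule powr_divide[symmetric])
      also have "\<dots> \<le> (real m / real f) powr (1 - \<alpha>)"
        using nm \<alpha> by (intro powr_mono2) auto
      finally have "?D / 24 \<le> real \<sigma> powr \<alpha> * (real m / real f) powr (1 - \<alpha>) / 8"
        using mult_left_mono[of _ _ "real \<sigma> powr \<alpha>"] by fastforce
      also have "real \<sigma> powr \<alpha> * (real m / real f) powr (1 - \<alpha>)
          = real \<sigma> * (real m / (real \<sigma> * real f)) powr (1 - \<alpha>)"
      proof -
        have "real \<sigma> = real \<sigma> powr \<alpha> * real \<sigma> powr (1 - \<alpha>)"
          using assms(3) by (simp flip: powr_add)
        moreover have "(real m / real f) powr (1 - \<alpha>)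
            = real \<sigma> powr (1 - \<alpha>) * (real m / (real \<sigma> * real f)) powr (1 - \<alpha>)"
          using assms(3) by (simp flip: powr_mult)
        ultimately show ?thesis by (metis mult.assoc)
      qed
      finally show ?thesis using X(5) True mult_left_mono[OF X(5), of "real s"] by simp
    next
      case False
      then have "s = m div f" by (simp add: s_def min_def split: if_splits)
      \<comment> \<open>A quotient rounded down to \<open>s \<ge> 1\<close> is less than
        \<open>s + 1\<close>, hence at most \<open>2 * s\<close>.\<close>
      then have "m < (s + 1) * f" using assms(1) dividend_less_div_times[of f m] by simp
      then have "m \<le> (2 * s) * f" 
        using s(1) mult_le_mono1[of "s + 1" "2 * s" f] by linarith
      then have "real m \<le> 2 * real s * real f" by (metis of_nat_le_iff of_nat_mult of_nat_numeral)
      then have "real m / real f \<le> 2 * real s" using f by (simp add: field_simps)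
      moreover have "real n / real f \<le> 3 * (real m / real f)" using nm by simp
      ultimately have "?D \<le> 24 * real s" using D by linarith
      then have "?D / 24 \<le> real s" by simp
      also have "\<dots> \<le> real (s * card X)"
        using X(1,2) by (simp add: Suc_leI card_gt_0_iff flip: of_nat_mult)
      finally show ?thesis .
    qed
    then show ?thesis
      using X s(2) \<alpha>(3) by (intro exI[of _ X] exI[of _ s]) (auto simp: m_def \<alpha>_def)
  qed
qed

section \<open>Lower bounds for spanners and preservers\<close>

lemma ft_preserver_imp_spanner: "ft_preserver k P G H \<Longrightarrow> ft_additive_spanner k 1 P G H"
proof -
  have "b \<le> c + enat 0 \<Longrightarrow> b \<le> c + enat 1" for b c :: enat
    by (erule order_trans) (simp add: add_left_mono)
  then show "ft_preserver k P G H \<Longrightarrow> ft_additive_spanner k 1 P G H"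
    unfolding ft_preserver_def ft_additive_spanner_def by blast
qed

text \<open>Each side uses half of the vertices and contributes one factor:
  \<open>576 = 24 * 24\<close>, and the exponent of \<open>n / f\<close> is twice
  \<open>f / (f + 1)\<close>.\<close>

lemma spanner_lower_bound:
  fixes f n \<sigma> \<tau> :: nat
  assumes "1 \<le> f" "2 \<le> n" "\<sigma> \<le> n" "\<tau> \<le> n"
  shows "\<exists>(G :: nat ugraph) S T.
    simple_graph G \<and> card (verts G) = n \<and>
    S \<subseteq> verts G \<and> card S = \<sigma> \<and> T \<subseteq> verts G \<and> card T = \<tau> \<and>
    (\<forall>H. ft_additive_spanner (2 * f) 1 (S \<times> T) G H \<longrightarrow>
      1 / 576 * (real \<sigma> powr (1 / (real f + 1)) * real \<tau> powr (1 / (real f + 1)) *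
        (real n / real f) powr (2 - 2 / (real f + 1))) \<le> real (card (edges H)))"
proof (cases "\<sigma> = 0 \<or> \<tau> = 0")
  \<comment> \<open>\<open>0 powr a\<close> is 0, so the bound vanishes and an edgeless graph
    serves.\<close>
  case True
  then show ?thesis
    using assms
    by (intro exI[of _ "UGraph {..<n} {}"] exI[of _ "{..<\<sigma>}"] exI[of _ "{..<\<tau>}"])
       (auto simp: simple_graph_def)
next
  case False
  let ?d = "\<lambda>\<sigma>. real \<sigma> powr (1 / (real f + 1)) * (real n / real f) powr (real f / (real f + 1)) / 24"
  obtain X :: "bool list set" and k where X: "finite X" "X \<noteq> {}" "isolable f X" "k \<le> \<sigma>"
    "k * card (prefix_closure X) \<le> n div 2" "?d \<sigma> \<le> real (k * card X)"
    using isolable_words_for_terminals[of f n \<sigma>] assms False by auto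
  obtain Y :: "bool list set" and l where Y: "finite Y" "Y \<noteq> {}" "isolable f Y" "l \<le> \<tau>"
    "l * card (prefix_closure Y) \<le> n div 2" "?d \<tau> \<le> real (l * card Y)"
    using isolable_words_for_terminals[of f n \<tau>] assms False by auto
  have e: "2 - 2 / (real f + 1) = real f / (real f + 1) + real f / (real f + 1)"
    by (simp add: add_divide_distrib[symmetric] diff_divide_eq_iff)
  have "1 / 576 * (real \<sigma> powr (1 / (real f + 1)) * real \<tau> powr (1 / (real f + 1)) *
      (real n / real f) powr (2 - 2 / (real f + 1))) = ?d \<sigma> * ?d \<tau>"
    by (simp only: e powr_add) simp
  also have "\<dots> \<le> real (k * card X) * real (l * card Y)"
    using X(6) Y(6) by (intro mult_mono) auto
  finally have bound: "1 / 576 * (real \<sigma> powr (1 / (real f + 1)) * real \<tau> powr (1 / (real f + 1)) *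
      (real n / real f) powr (2 - 2 / (real f + 1))) \<le> real ((k * card X) * (l * card Y))"
    by (simp only: of_nat_mult)
  have "k * card (prefix_closure X) + l * card (prefix_closure Y) \<le> n"
    using X(5) Y(5) by linarith
  from trie_graph_exists[OF X(1-3) Y(1-3) this X(4) assms(3) Y(4) assms(4)]
  obtain G :: "nat ugraph" and S T where
    G: "simple_graph G" "card (verts G) = n" "S \<subseteq> verts G" "card S = \<sigma>" "T \<subseteq> verts G" "card T = \<tau>"
    and H: "\<And>H. ft_additive_spanner (2 * f) 1 (S \<times> T) G H \<Longrightarrow>
      (k * card X) * (l * card Y) \<le> card (edges H)"
    by blast
  show ?thesis
    by (intro exI[of _ G] exI[of _ S] exI[of _ T] conjI G allI impI)
       (rule order_trans[OF bound], rule of_nat_mono, erule H)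
qed

theorem theorem10:
  "\<exists>c::real. c > 0 \<and>
     (\<forall>f n \<sigma> \<tau> :: nat. 1 \<le> f \<and> 2 \<le> n \<and> \<sigma> \<le> n \<and> \<tau> \<le> n \<longrightarrow>
       (\<exists>(G :: nat ugraph) S T.
          simple_graph G \<and> card (verts G) = n \<and>
          S \<subseteq> verts G \<and> card S = \<sigma> \<and> T \<subseteq> verts G \<and> card T = \<tau> \<and>
          (\<forall>H. ft_additive_spanner (2 * f) 1 (S \<times> T) G H \<longrightarrow>
             real (card (edges H)) \<ge>
               c * (real (card S) powr (1 / (real f + 1)) *
                    real (card T) powr (1 / (real f + 1)) *
                    (real n / real f) powr (2 - 2 / (real f + 1)))) \<and>
          (\<forall>H. ft_preserver (2 * f) (S \<times> T) G H \<longrightarrow>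
             real (card (edges H)) \<ge>
               c * (real (card S) powr (1 / (real f + 1)) *
                    real (card T) powr (1 / (real f + 1)) *
                    (real n / real f) powr (2 - 2 / (real f + 1))))))"
proof (intro exI[of _ "1 / 576"] conjI allI impI)
  fix f n \<sigma> \<tau> :: nat
  assume "1 \<le> f \<and> 2 \<le> n \<and> \<sigma> \<le> n \<and> \<tau> \<le> n"
  then obtain G :: "nat ugraph" and S T where
    G: "simple_graph G" "card (verts G) = n" "S \<subseteq> verts G" "card S = \<sigma>" "T \<subseteq> verts G" "card T = \<tau>"
    and H: "\<And>H. ft_additive_spanner (2 * f) 1 (S \<times> T) G H \<Longrightarrow>
      1 / 576 * (real \<sigma> powr (1 / (real f + 1)) * real \<tau> powr (1 / (real f + 1)) *
        (real n / real f) powr (2 - 2 / (real f + 1))) \<le> real (card (edges H))"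
    using spanner_lower_bound[of f n \<sigma> \<tau>] by metis
  show "\<exists>(G :: nat ugraph) S T.
      simple_graph G \<and> card (verts G) = n \<and>
      S \<subseteq> verts G \<and> card S = \<sigma> \<and> T \<subseteq> verts G \<and> card T = \<tau> \<and>
      (\<forall>H. ft_additive_spanner (2 * f) 1 (S \<times> T) G H \<longrightarrow>
         real (card (edges H)) \<ge>
           1 / 576 * (real (card S) powr (1 / (real f + 1)) *
                real (card T) powr (1 / (real f + 1)) *
                (real n / real f) powr (2 - 2 / (real f + 1)))) \<and>
      (\<forall>H. ft_preserver (2 * f) (S \<times> T) G H \<longrightarrow>
         real (card (edges H)) \<ge>
           1 / 576 * (real (card S) powr (1 / (real f + 1)) *
                real (card T) powr (1 / (real f + 1)) *
                (real n / real f) powr (2 - 2 / (real f + 1))))"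
    unfolding G(4,6)[symmetric]
    by (intro exI[of _ G] exI[of _ S] exI[of _ T] conjI G refl allI impI; unfold G(4,6))
       (erule H, erule H[OF ft_preserver_imp_spanner])
qed simp

end
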